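(* Let $G$ be a set and let $k,\ell\ge 1$ be integers. For every $\vec r=(r_1,\dots,r_k)\in\mathbb Z_{\ge1}^k$, $\vec a\in G^k$, $\vec s=(s_1,\dots,s_\ell)\in\mathbb Z_{\ge1}^\ell$, $\vec b\in G^\ell$, the following identity holds in $(\mathcal H(\mathbb Z_{\ge1}\times G),\sqcup\!\sqcup_\rho)$: $$\binom{\vec r}{\vec a}\sqcup\!\sqcup_\rho\binom{\vec s}{\vec b}=\sum_{(\varphi,\psi)\in I_{k,\ell}}\ \sum_{\substack{\vec t\in\mathbb Z_{\ge1}^{k+\ell}\\ |\vec t|=|\vec r|+|\vec s|}} c_{\vec r,\vec s}^{\vec t,(\varphi,\psi)}\binom{\vec t}{\vec a\sqcup\!\sqcup_{(\varphi,\psi)}\vec b}.$$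
   Context: Words and the algebra: for a set $G$, an element of the free monoid on $\mathbb Z_{\ge1}\times G$ is written $\binom{s_1,\dots,s_k}{b_1,\dots,b_k}=\binom{\vec s}{\vec b}$ (the word $(s_1,b_1)\cdots(s_k,b_k)$); the empty word is $1$. $\mathcal H(\mathbb Z_{\ge1}\times G)$ is the free abelian group with these words as basis. Let $x_0$ and $x_b$ ($b\in G$) be pairwise distinct letters (indexed by the disjoint union $\{0\}\sqcup G$), and let $\sqcup\!\sqcup$ be the shuffle product on the free abelian group on words in these letters, defined by $1\sqcup\!\sqcup w=w\sqcup\!\sqcup 1=w$ and $(a_1u)\sqcup\!\sqcup(b_1v)=a_1(u\sqcup\!\sqcup b_1v)+b_1(a_1u\sqcup\!\sqcup v)$ for letters $a_1,b_1$ and words $u,v$. The span $\mathcal H_1$ of $1$ and of the words ending in some $x_b$, $b\in G$, is closed under $\sqcup\!\sqcup$, and the words $x_0^{s_1-1}x_{b_1}\cdots x_0^{s_k-1}x_{b_k}$ ($s_i\ge1$, $b_i\in G$, $k\ge1$) together with $1$ form a basis of it. Let $\rho:\mathcal H_1\to\mathcal H(\mathbb Z_{\ge1}\times G)$ be the linear bijection $x_0^{s_1-1}x_{b_1}\cdots x_0^{s_k-1}x_{b_k}\mapsto\binom{s_1,\dots,s_k}{b_1,\dots,b_k}$, $1\mapsto 1$, and define $u\sqcup\!\sqcup_\rho v=\rho(\rho^{-1}(u)\sqcup\!\sqcup\rho^{-1}(v))$. Coefficients: $[k]=\{1,\dots,k\}$. $I_{k,\ell}$ is the set of pairs $(\varphi,\psi)$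 of order-preserving injective maps $\varphi:[k]\to[k+\ell]$, $\psi:[\ell]\to[k+\ell]$ with $\mathrm{im}\,\varphi\sqcup\mathrm{im}\,\psi=[k+\ell]$. For $\vec a\in G^k,\vec b\in G^\ell$, $\vec a\sqcup\!\sqcup_{(\varphi,\psi)}\vec b\in G^{k+\ell}$ has $i$-th entry $a_j$ if $i=\varphi(j)$ and $b_j$ if $i=\psi(j)$. $|\vec x|$ denotes the sum of the entries. For $\vec t\in\mathbb Z_{\ge1}^{k+\ell}$ with $|\vec t|=|\vec r|+|\vec s|$ and $(\varphi,\psi)\in I_{k,\ell}$, put $h_i=r_j$ if $i=\varphi(j)$ and $h_i=s_j$ if $i=\psi(j)$, and $\varepsilon(i)=1$ if $i\in\mathrm{im}\,\varphi$, $\varepsilon(i)=-1$ if $i\in\mathrm{im}\,\psi$. Define $c(i)=\binom{t_i-1}{h_i-1}$ if $i=1$ or if $i\ge2$ and $\varepsilon(i)=\varepsilon(i-1)$; and $c(i)=\binom{t_i-1}{\sum_{j=1}^i t_j-\sum_{j=1}^i h_j}$ if $i\ge2$ and $\varepsilon(i)\ne\varepsilon(i-1)$. Here for integers $a\ge0$ and $b$, $\binom{a}{b}$ is the usual binomial coefficient if $0\le b\le a$ and $0$ otherwise. Finally $c_{\vec r,\vec s}^{\vec t,(\varphi,\psi)}=\prod_{i=1}^{k+\ell}c(i)$. *)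

theory Defs
  imports "HOL-Algebra.Free_Abelian_Groups" "HOL-Library.FuncSet"
begin

text \<open>
  Elements of the free abelian group on a set of words are finitely supported integer-valued
  functions on lists, as in \<^const>\<open>free_Abelian_group\<close>; \<^const>\<open>frag_of\<close> embeds the basis and
  \<^const>\<open>frag_extend\<close> is linear extension.
\<close>

definition sH_words :: "'g set \<Rightarrow> (nat \<times> 'g) list set" where
  "sH_words G = lists ({1..} \<times> G)"

definition sH :: "'g set \<Rightarrow> ((nat \<times> 'g) list \<Rightarrow>\<^sub>0 int) set" where
  "sH G = carrier (free_Abelian_group (sH_words G))"

text \<open>The letter \<open>x\<^sub>0\<close> is \<^const>\<open>None\<close> and \<open>x\<^sub>b\<close> is \<open>Some b\<close>.\<close>

definition H1_words :: "'g set \<Rightarrow> 'g option list set" where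
  "H1_words G = {w \<in> lists (insert None (Some ` G)). w = [] \<or> (\<exists>b\<in>G. last w = Some b)}"

definition H1 :: "'g set \<Rightarrow> ('g option list \<Rightarrow>\<^sub>0 int) set" where
  "H1 G = carrier (free_Abelian_group (H1_words G))"

fun shuffle_words :: "'x list \<Rightarrow> 'x list \<Rightarrow> ('x list \<Rightarrow>\<^sub>0 int)" where
  "shuffle_words [] w = frag_of w"
| "shuffle_words w [] = frag_of w"
| "shuffle_words (a # u) (b # v) =
     frag_extend (\<lambda>w. frag_of (a # w)) (shuffle_words u (b # v)) +
     frag_extend (\<lambda>w. frag_of (b # w)) (shuffle_words (a # u) v)"

definition shuffle_prod ::
    "('x list \<Rightarrow>\<^sub>0 int) \<Rightarrow> ('x list \<Rightarrow>\<^sub>0 int) \<Rightarrow> ('x list \<Rightarrow>\<^sub>0 int)" where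
  "shuffle_prod p q = frag_extend (\<lambda>u. frag_extend (\<lambda>v. shuffle_words u v) q) p"

definition xword :: "(nat \<times> 'g) list \<Rightarrow> 'g option list" where
  "xword w = concat (map (\<lambda>(s, b). replicate (s - 1) None @ [Some b]) w)"

text \<open>
  The linear map sending \<open>xword w\<close> to \<open>w\<close>; see \<open>rho_xword\<close> and \<open>bij_betw_rho\<close> below.
\<close>

definition rho :: "'g set \<Rightarrow> ('g option list \<Rightarrow>\<^sub>0 int) \<Rightarrow> ((nat \<times> 'g) list \<Rightarrow>\<^sub>0 int)" where
  "rho G = frag_extend (\<lambda>u. frag_of (the_inv_into (sH_words G) xword u))"

definition shuffle_rho :: "'g set \<Rightarrow> ((nat \<times> 'g) list \<Rightarrow>\<^sub>0 int) \<Rightarrow> ((nat \<times> 'g) list \<Rightarrow>\<^sub>0 int)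
    \<Rightarrow> ((nat \<times> 'g) list \<Rightarrow>\<^sub>0 int)" where
  "shuffle_rho G u v =
     rho G (shuffle_prod (the_inv_into (H1 G) (rho G) u) (the_inv_into (H1 G) (rho G) v))"

text \<open>
  Vectors of length \<open>n\<close> are functions on \<open>{1..n}\<close>. Where a set of vectors or maps is summed over,
  they are extensional, so that each is counted once.
\<close>

definition word :: "nat \<Rightarrow> (nat \<Rightarrow> nat) \<Rightarrow> (nat \<Rightarrow> 'g) \<Rightarrow> (nat \<times> 'g) list" where
  "word n s b = map (\<lambda>i. (s i, b i)) [1..<n+1]"

definition I_set :: "nat \<Rightarrow> nat \<Rightarrow> ((nat \<Rightarrow> nat) \<times> (nat \<Rightarrow> nat)) set" where
  "I_set k l = {(\<phi>, \<psi>).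
     \<phi> \<in> {1..k} \<rightarrow>\<^sub>E {1..k+l} \<and> mono_on {1..k} \<phi> \<and> inj_on \<phi> {1..k} \<and>
     \<psi> \<in> {1..l} \<rightarrow>\<^sub>E {1..k+l} \<and> mono_on {1..l} \<psi> \<and> inj_on \<psi> {1..l} \<and>
     \<phi> ` {1..k} \<inter> \<psi> ` {1..l} = {} \<and> \<phi> ` {1..k} \<union> \<psi> ` {1..l} = {1..k+l}}"

definition merge_vec :: "nat \<Rightarrow> nat \<Rightarrow> (nat \<Rightarrow> nat) \<times> (nat \<Rightarrow> nat) \<Rightarrow>
    (nat \<Rightarrow> 'x) \<Rightarrow> (nat \<Rightarrow> 'x) \<Rightarrow> nat \<Rightarrow> 'x" where
  "merge_vec k l = (\<lambda>(\<phi>, \<psi>) a b i.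
     if i \<in> \<phi> ` {1..k} then a (the_inv_into {1..k} \<phi> i) else b (the_inv_into {1..l} \<psi> i))"

definition weight_set :: "nat \<Rightarrow> nat \<Rightarrow> (nat \<Rightarrow> nat) set" where
  "weight_set n m = {t \<in> {1..n} \<rightarrow>\<^sub>E {1..}. (\<Sum>i=1..n. t i) = m}"

definition binom :: "int \<Rightarrow> int \<Rightarrow> int" where
  "binom a b = (if 0 \<le> b \<and> b \<le> a then int (nat a choose nat b) else 0)"

definition eps :: "nat \<Rightarrow> (nat \<Rightarrow> nat) \<times> (nat \<Rightarrow> nat) \<Rightarrow> nat \<Rightarrow> int" where
  "eps k = (\<lambda>(\<phi>, \<psi>) i. if i \<in> \<phi> ` {1..k} then 1 else -1)"

definition coeff_factor :: "nat \<Rightarrow> nat \<Rightarrow> (nat \<Rightarrow> nat) \<Rightarrow> (nat \<Rightarrow> nat) \<Rightarrow> (nat \<Rightarrow> nat) \<Rightarrow>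
    (nat \<Rightarrow> nat) \<times> (nat \<Rightarrow> nat) \<Rightarrow> nat \<Rightarrow> int" where
  "coeff_factor k l r s t \<phi>\<psi> i =
     (let h = merge_vec k l \<phi>\<psi> r s in
      if i = 1 \<or> (i \<ge> 2 \<and> eps k \<phi>\<psi> i = eps k \<phi>\<psi> (i - 1))
      then binom (int (t i) - 1) (int (h i) - 1)
      else binom (int (t i) - 1) ((\<Sum>j=1..i. int (t j)) - (\<Sum>j=1..i. int (h j))))"

definition shuffle_coeff :: "nat \<Rightarrow> nat \<Rightarrow> (nat \<Rightarrow> nat) \<Rightarrow> (nat \<Rightarrow> nat) \<Rightarrow> (nat \<Rightarrow> nat) \<Rightarrow>
    (nat \<Rightarrow> nat) \<times> (nat \<Rightarrow> nat) \<Rightarrow> int" where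
  "shuffle_coeff k l r s t \<phi>\<psi> = (\<Prod>i=1..k+l. coeff_factor k l r s t \<phi>\<psi> i)"


lemma xword_Nil [simp]: "xword [] = []"
  and xword_Cons [simp]: "xword ((s, b) # w) = replicate (s - 1) None @ Some b # xword w"
  by (simp_all add: xword_def)

lemma replicate_None_eqD:
  "replicate m None @ Some b # u = replicate n None @ Some c # v \<Longrightarrow> m = n \<and> b = c \<and> u = v"
proof (induction m arbitrary: n)
  case 0
  then show ?case by (cases n) auto
next
  case (Suc m)
  then show ?case by (cases n) auto
qed

lemma xword_inj: "inj_on xword (sH_words G)"
proof (rule inj_onI)
  fix v w assume "v \<in> sH_words G" "w \<in> sH_words G" "xword v = xword w"
  then show "v = w"
  proof (induction v arbitrary: w)
    case Nil
    then show ?case by (cases w) auto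
  next
    case (Cons x v)
    then obtain y w' where w: "w = y # w'" by (cases w; cases x) auto
    obtain s b s' b' where xy: "x = (s, b)" "y = (s', b')" by (cases x, cases y) auto
    have "s - 1 = s' - 1" "b = b'" "xword v = xword w'"
      using replicate_None_eqD[OF Cons.prems(3)[unfolded w xy xword_Cons]] by auto
    with Cons show ?case by (auto simp: w xy sH_words_def)
  qed
qed

lemma xword_in_H1_words: "w \<in> sH_words G \<Longrightarrow> xword w \<in> H1_words G"
proof (induction w)
  case Nil
  then show ?case by (simp add: H1_words_def)
next
  case (Cons x w)
  then show ?case by (cases x) (auto simp: H1_words_def sH_words_def)
qed

lemma xword_surj: "u \<in> H1_words G \<Longrightarrow> u \<in> xword ` sH_words G"
proof (induction u)
  case Nil
  then show ?case by (auto simp: sH_words_def image_iff intro!: bexI[of _ "[]"])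
next
  case (Cons x u)
  from Cons.prems have "u \<in> H1_words G"
    by (auto simp: H1_words_def split: if_splits)
  with Cons.IH obtain w where w: "w \<in> sH_words G" "u = xword w" by auto
  show ?case
  proof (cases x)
    case None
    with Cons.prems have "u \<noteq> []" by (auto simp: H1_words_def)
    with w obtain s b w' where w': "w = (s, b) # w'" by (cases w) auto
    then have "x # u = xword ((Suc s, b) # w')" "(Suc s, b) # w' \<in> sH_words G"
      using w None by (auto simp: sH_words_def simp flip: replicate_Suc append_Cons)
    then show ?thesis by blast
  next
    case (Some b)
    then have "x # u = xword ((1, b) # w)" "(1, b) # w \<in> sH_words G"
      using w Cons.prems by (auto simp: sH_words_def H1_words_def)
    then show ?thesis by blast
  qed
qed

lemma bij_betw_xword: "bij_betw xword (sH_words G) (H1_words G)"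
  using xword_inj xword_in_H1_words xword_surj unfolding bij_betw_def by blast

lemma rho_xword: "w \<in> sH_words G \<Longrightarrow> rho G (frag_of (xword w)) = frag_of w"
  by (simp add: rho_def the_inv_into_f_f[OF xword_inj])

lemma bij_betw_rho: "bij_betw (rho G) (H1 G) (sH G)"
proof -
  define d where "d = the_inv_into (sH_words G) xword"
  define e where "e = frag_extend (frag_of \<circ> (xword :: (nat \<times> 'a) list \<Rightarrow> _))"
  have d: "d u \<in> sH_words G" "xword (d u) = u" if "u \<in> H1_words G" for u
    using that bij_betw_xword[of G] unfolding d_def bij_betw_def
    by (auto intro: the_inv_into_into f_the_inv_into_f)
  have d': "d (xword w) = w" if "w \<in> sH_words G" for w
    using that by (simp add: d_def the_inv_into_f_f[OF xword_inj])
  have rho: "rho G = frag_extend (frag_of \<circ> d)"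
    by (simp add: rho_def d_def comp_def)
  have ext_id: "frag_extend f p = p" if "\<And>x. x \<in> Poly_Mapping.keys p \<Longrightarrow> f x = frag_of x"
    for f and p :: "'x \<Rightarrow>\<^sub>0 int"
    using that by (subst (2) frag_expansion) (rule frag_extend_eq)
  show ?thesis
  proof (rule bij_betw_byWitness[where f' = e])
    show "\<forall>p\<in>H1 G. e (rho G p) = p"
      by (auto simp: e_def rho H1_def frag_extend_compose d subset_iff intro!: ext_id)
    show "\<forall>p\<in>sH G. rho G (e p) = p"
      by (auto simp: e_def rho sH_def frag_extend_compose d' subset_iff intro!: ext_id)
    show "rho G ` H1 G \<subseteq> sH G"
      using d(1) by (auto simp: rho H1_def sH_def subset_iff dest!: subsetD[OF keys_frag_extend])
    show "e ` sH G \<subseteq> H1 G"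
      using xword_in_H1_words[of _ G]
      by (auto simp: e_def H1_def sH_def subset_iff dest!: subsetD[OF keys_frag_extend])
  qed
qed

lemma keys_shuffle_words:
  assumes "u \<in> H1_words G" "v \<in> H1_words G"
  shows "Poly_Mapping.keys (shuffle_words u v) \<subseteq> H1_words G"
proof -
  have tl: "u \<in> H1_words G" if "x # u \<in> H1_words G" for x u
    using that by (auto simp: H1_words_def split: if_splits)
  have cons: "x # w \<in> H1_words G" if "x # u \<in> H1_words G" "w \<in> H1_words G" "w \<noteq> []" for x u w
    using that by (auto simp: H1_words_def)
  have nonempty: "[] \<notin> Poly_Mapping.keys (shuffle_words u v)" if "u \<noteq> [] \<or> v \<noteq> []"
    for u v :: "'a option list"
    using that
  proof (induction u v rule: shuffle_words.induct)
    case (3 a u b v)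
    then show ?case
      by (auto dest!: subsetD[OF keys_add] subsetD[OF keys_frag_extend])
  qed auto
  show ?thesis
    using assms
  proof (induction u v rule: shuffle_words.induct)
    case (3 a u b v)
    have *: "Poly_Mapping.keys (frag_extend (\<lambda>w. frag_of (x # w)) p) \<subseteq> H1_words G"
      if "Poly_Mapping.keys p \<subseteq> H1_words G" "[] \<notin> Poly_Mapping.keys p" "x # y \<in> H1_words G" for x y p
    proof
      fix z assume "z \<in> Poly_Mapping.keys (frag_extend (\<lambda>w. frag_of (x # w)) p)"
      then obtain w where "w \<in> Poly_Mapping.keys p" "z = x # w"
        by (auto dest!: subsetD[OF keys_frag_extend])
      then show "z \<in> H1_words G" using that cons by blast
    qed
    have "Poly_Mapping.keys (shuffle_words u (b # v)) \<subseteq> H1_words G"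
      "Poly_Mapping.keys (shuffle_words (a # u) v) \<subseteq> H1_words G"
      using 3 tl by blast+
    then show ?case
      unfolding shuffle_words.simps
      by (intro order_trans[OF keys_add] Un_least *[OF _ _ 3(3)] *[OF _ _ 3(4)])
        (simp_all add: nonempty)
  qed auto
qed

lemma shuffle_prod_closed:
  assumes "p \<in> H1 G" "q \<in> H1 G"
  shows "shuffle_prod p q \<in> H1 G"
proof -
  have "w \<in> H1_words G" if w: "w \<in> Poly_Mapping.keys (shuffle_prod p q)" for w
  proof -
    obtain u where "u \<in> Poly_Mapping.keys p"
      "w \<in> Poly_Mapping.keys (frag_extend (\<lambda>v. shuffle_words u v) q)"
      using subsetD[OF keys_frag_extend w[unfolded shuffle_prod_def]] by blast
    moreover from this(2) obtain v where "v \<in> Poly_Mapping.keys q"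
      "w \<in> Poly_Mapping.keys (shuffle_words u v)"
      using keys_frag_extend[of "\<lambda>v. shuffle_words u v" q] by blast
    ultimately show ?thesis
      using assms keys_shuffle_words[of u G v] by (auto simp: H1_def)
  qed
  then show ?thesis by (auto simp: H1_def)
qed

lemma finite_I_set: "finite (I_set k l)"
  by (rule finite_subset[of _ "({1..k} \<rightarrow>\<^sub>E {1..k+l}) \<times> ({1..l} \<rightarrow>\<^sub>E {1..k+l})"])
    (auto simp only: I_set_def intro!: finite_PiE finite_cartesian_product finite_atLeastAtMost)

lemma finite_weight_set: "finite (weight_set n m)"
proof (rule finite_subset)
  show "weight_set n m \<subseteq> {1..n} \<rightarrow>\<^sub>E {..m}"
  proof
    fix t assume t: "t \<in> weight_set n m"
    have "t i \<le> m" if "i \<in> {1..n}" for i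
      using t that member_le_sum[of i "{1..n}" t] by (auto simp: weight_set_def)
    with t show "t \<in> {1..n} \<rightarrow>\<^sub>E {..m}" by (auto simp: weight_set_def PiE_iff)
  qed
qed (intro finite_PiE finite_atLeastAtMost finite_atMost)

end

theory Submission
  imports Defs
begin

text \<open>
  Every interleaving of the blocks contributes one product of binomial coefficients for each
  choice of block lengths \<open>t\<close>. Splitting off the first letter shows that these sums obey the
  same recursion as the shuffle product. If \<open>t\<^sub>1 = 1\<close>, the first letter is \<open>x\<^sub>a\<close> or \<open>x\<^sub>b\<close> and
  the first block disappears; its factor is 1 if the block had length 1, and 0 otherwise. If
  \<open>t\<^sub>1 > 1\<close>, the first letter is an \<open>x\<^sub>0\<close> from one of the two words. Shortening the first block of
  that word by one leaves all factors but the first unchanged, so that the recursion is Pascal's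
  rule for the first factor.
\<close>

subsection \<open>Interleavings and compositions\<close>

fun interleave :: "bool list \<Rightarrow> 'x list \<Rightarrow> 'x list \<Rightarrow> 'x list" where
  "interleave (True # ps) (x # xs) ys = x # interleave ps xs ys"
| "interleave (False # ps) xs (y # ys) = y # interleave ps xs ys"
| "interleave ps xs ys = []"

lemma interleave_swap: "interleave (map Not ps) ys xs = interleave ps xs ys"
  by (induction ps xs ys rule: interleave.induct) auto

lemma set_interleave_subset: "set (interleave ps xs ys) \<subseteq> set xs \<union> set ys"
  by (induction ps xs ys rule: interleave.induct) auto

lemma interleave_replicate_True: "interleave (replicate (length xs) True) xs [] = xs"
  by (induction xs) auto

lemma interleave_map_filter:
  "interleave (map P xs) (map f (filter P xs)) (map g (filter (\<lambda>x. \<not> P x) xs)) =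
     map (\<lambda>x. if P x then f x else g x) xs"
  by (induction xs) auto

lemma map_shuffles: "map f ` shuffles xs ys = shuffles (map f xs) (map f ys)"
proof -
  have "map f ` (#) x ` S = (#) (f x) ` map f ` S" for x S
    by (simp add: image_image)
  then show ?thesis
    by (induction xs ys rule: shuffles.induct) (simp_all add: image_Un)
qed

text \<open>\<open>True\<close> marks the positions of the blocks of the first word.\<close>

definition patterns :: "nat \<Rightarrow> nat \<Rightarrow> bool list set" where
  "patterns k l = shuffles (replicate k True) (replicate l False)"

lemma length_pattern: "ps \<in> patterns k l \<Longrightarrow> length ps = k + l"
  by (auto simp: patterns_def dest: length_shuffles)

lemma finite_patterns: "finite (patterns k l)"
  by (simp add: patterns_def)

lemma patterns_0_right: "patterns k 0 = {replicate k True}"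
  by (simp add: patterns_def)

lemma False_in_set_pattern: "ps \<in> patterns k (Suc l) \<Longrightarrow> False \<in> set ps"
  by (auto simp: patterns_def dest: set_shuffles)

lemma patterns_swap: "patterns l k = map Not ` patterns k l"
  by (simp add: patterns_def map_shuffles shuffles_commutes)

lemma sum_patterns_Suc_Suc:
  "(\<Sum>ps\<in>patterns (Suc k) (Suc l). f ps) =
     (\<Sum>ps\<in>patterns k (Suc l). f (True # ps)) + (\<Sum>ps\<in>patterns (Suc k) l. f (False # ps))"
proof -
  have "patterns (Suc k) (Suc l) = (#) True ` patterns k (Suc l) \<union> (#) False ` patterns (Suc k) l"
    by (simp add: patterns_def)
  moreover have "(#) True ` patterns k (Suc l) \<inter> (#) False ` patterns (Suc k) l = {}"
    by blast
  ultimately show ?thesis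
    by (simp add: sum.union_disjoint sum.reindex finite_patterns)
qed

lemma mem_patterns_iff:
  "ps \<in> patterns k l \<longleftrightarrow> length (filter (\<lambda>p. p) ps) = k \<and> length (filter Not ps) = l"
proof
  assume "ps \<in> patterns k l"
  then have "filter P ps \<in> shuffles (filter P (replicate k True)) (filter P (replicate l False))"
    for P
    unfolding patterns_def filter_shuffles[symmetric] by (rule imageI)
  from this[of "\<lambda>p. p"] this[of Not]
  show "length (filter (\<lambda>p. p) ps) = k \<and> length (filter Not ps) = l"
    by simp
next
  assume "length (filter (\<lambda>p. p) ps) = k \<and> length (filter Not ps) = l"
  then have "filter (\<lambda>p. p) ps = replicate k True" "filter Not ps = replicate l False"
    by (auto intro!: replicate_eqI)
  with partition_in_shuffles[of ps "\<lambda>p. p"] show "ps \<in> patterns k l"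
    by (simp add: patterns_def)
qed

lemma map_in_patterns_iff:
  "map P xs \<in> patterns k l \<longleftrightarrow>
     length (filter P xs) = k \<and> length (filter (\<lambda>x. \<not> P x) xs) = l"
  by (simp add: mem_patterns_iff filter_map o_def)

definition compositions :: "nat \<Rightarrow> nat \<Rightarrow> nat list set" where
  "compositions n m = {ts. length ts = n \<and> set ts \<subseteq> {1..} \<and> sum_list ts = m}"

lemma set_composition: "ts \<in> compositions n m \<Longrightarrow> set ts \<subseteq> {1..}"
  by (simp add: compositions_def)

lemma finite_compositions: "finite (compositions n m)"
proof (rule finite_subset[OF _ finite_lists_length_eq[of "{..m}" n]])
  show "compositions n m \<subseteq> {xs. set xs \<subseteq> {..m} \<and> length xs = n}"
    by (auto simp: compositions_def dest: member_le_sum_list)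
qed simp

lemma sum_compositions_Suc:
  "(\<Sum>ts\<in>compositions (Suc n) m. f ts) = (\<Sum>t=1..m. \<Sum>ts\<in>compositions n (m - t). f (t # ts))"
proof -
  have "(\<Sum>ts\<in>compositions (Suc n) m. f ts) =
      (\<Sum>(t, ts)\<in>Sigma {1..m} (\<lambda>t. compositions n (m - t)). f (t # ts))"
    by (rule sum.reindex_bij_witness[of _ "\<lambda>(t, ts). t # ts" "\<lambda>ts. (hd ts, tl ts)"])
      (auto simp: compositions_def length_Suc_conv)
  then show ?thesis by (simp add: sum.Sigma finite_compositions)
qed

lemma sum_compositions_Suc_Suc:
  "(\<Sum>ts\<in>compositions (Suc n) (Suc m). f ts) =
     (\<Sum>ts\<in>compositions n m. f (1 # ts)) +
     (\<Sum>ts\<in>compositions (Suc n) m. f (Suc (hd ts) # tl ts))"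
  unfolding sum_compositions_Suc
  by (simp add: sum.atLeast_Suc_atMost sum.shift_bounds_cl_Suc_ivl del: sum.cl_ivl_Suc)

subsection \<open>The coefficients of an interleaving\<close>

lemma binom_symmetric: "0 \<le> n \<Longrightarrow> binom n m = binom n (n - m)"
  by (auto simp: binom_def nat_diff_distrib binomial_symmetric[of "nat m" "nat n"])

lemma binom_of_nat: "binom (int n) (int m) = int (n choose m)"
  by (auto simp: binom_def)

lemma binom_Pascal:
  assumes "n > 0"
  shows "binom n m = binom (n - 1) (m - 1) + binom (n - 1) m"
proof (cases "m > 0")
  case True
  with assms obtain i j where "n = int (Suc i)" "m = int (Suc j)"
    by (metis gr0_conv_Suc zero_less_imp_eq_int)
  then have "n - 1 = int i" "m - 1 = int j" by simp_all
  then show ?thesis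
    using binom_of_nat[of "Suc i" "Suc j"] binom_of_nat[of i j] binom_of_nat[of i "Suc j"]
      \<open>n = _\<close> \<open>m = _\<close> by simp
qed (use assms in \<open>auto simp: binom_def\<close>)

text \<open>
  \<open>q\<close> tells which word the preceding block came from. The blocks so far are longer by \<open>x\<close> than
  those of the two words that they replace, so \<open>x\<close> letters of the next block of the other word
  are used up.
\<close>

fun tail_coeff :: "bool \<Rightarrow> int \<Rightarrow> bool list \<Rightarrow> nat list \<Rightarrow> nat list \<Rightarrow> int" where
  "tail_coeff q x [] [] [] = 1"
| "tail_coeff q x (p # ps) (h # hs) (t # ts) =
     binom (int t - 1) (if p = q then int h - 1 else x + int t - int h) *
     tail_coeff p (x + int t - int h) ps hs ts"
| "tail_coeff q x _ _ _ = 0"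

definition block_coeff :: "bool list \<Rightarrow> nat list \<Rightarrow> nat list \<Rightarrow> int" where
  "block_coeff = tail_coeff True 0"

lemma tail_coeff_swap: "tail_coeff (\<not> q) x (map Not ps) hs ts = tail_coeff q x ps hs ts"
  by (induction q x ps hs ts rule: tail_coeff.induct) auto

lemma block_coeff_eq_tail_coeff:
  assumes "set ts \<subseteq> {1..}"
  shows "block_coeff ps hs ts = tail_coeff q 0 ps hs ts"
proof -
  have "binom (int t - 1) (int h - 1) = binom (int t - 1) (int t - int h)" if "t \<ge> 1" for t h
    using binom_symmetric[of "int t - 1" "int h - 1"] that by simp
  with assms show ?thesis
    unfolding block_coeff_def by (cases ps; cases hs; cases ts) auto
qed

lemma block_coeff_swap:
  "set ts \<subseteq> {1..} \<Longrightarrow> block_coeff (map Not ps) hs ts = block_coeff ps hs ts"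
  using tail_coeff_swap[of True 0 ps hs ts] block_coeff_eq_tail_coeff[of ts _ _ False]
  by (simp add: block_coeff_def)

lemma block_coeff_Cons_1:
  assumes "set ts \<subseteq> {1..}"
  shows "block_coeff (p # ps) (Suc h # hs) (1 # ts) = (if h = 0 then block_coeff ps hs ts else 0)"
  using block_coeff_eq_tail_coeff[OF assms, of ps hs p]
  by (cases p) (auto simp: block_coeff_def binom_def)

lemma tail_coeff_interleave_Suc:
  "tail_coeff True (x + 1) ps (interleave ps rs (Suc s # ss)) ts =
    tail_coeff True x ps (interleave ps rs (s # ss)) ts"
proof (induction ps arbitrary: x rs ts)
  case Nil
  then show ?case by (cases ts) auto
next
  case (Cons p ps)
  show ?case
  proof (cases p)
    case True
    then show ?thesis
      using Cons.IH[of "x + int (hd ts) - int (hd rs)" "tl rs" "tl ts"]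
      by (cases rs; cases ts) (auto simp: algebra_simps)
  next
    case False
    then show ?thesis by (cases ts) (auto simp: algebra_simps)
  qed
qed

lemma tail_coeff_interleave_overdrawn:
  assumes "False \<in> set ps" "int s \<le> x"
  shows "tail_coeff True x ps (interleave ps rs (s # ss)) ts = 0"
  using assms
proof (induction ps arbitrary: x rs ts)
  case (Cons p ps)
  show ?case
  proof (cases p)
    case True
    show ?thesis
    proof (cases rs; cases ts)
      fix r rs' t ts' assume "rs = r # rs'" "ts = t # ts'"
      then show ?thesis
        using True Cons.IH[of "x + int t - int r" rs' ts'] Cons.prems
        by (cases "r \<le> t") (auto simp: binom_def)
    qed (use True in auto)
  next
    case False
    with Cons.prems show ?thesis
      by (cases ts) (auto simp: binom_def)
  qed
qed simp

lemma block_coeff_Pascal: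
  assumes "t \<ge> 1" "set ts \<subseteq> {1..}"
  shows "block_coeff ps (interleave ps (Suc r # rs) (Suc s # ss)) (Suc t # ts) =
    block_coeff ps (interleave ps (r # rs) (Suc s # ss)) (t # ts) +
    block_coeff ps (interleave ps (Suc r # rs) (s # ss)) (t # ts)"
proof -
  have Pascal_True: "block_coeff (True # ps) (Suc r # interleave ps rs (Suc s # ss)) (Suc t # ts) =
      block_coeff (True # ps) (r # interleave ps rs (Suc s # ss)) (t # ts) +
      block_coeff (True # ps) (Suc r # interleave ps rs (s # ss)) (t # ts)" for ps r rs s ss
    using tail_coeff_interleave_Suc[of "int t - int r - 1" ps rs s ss ts]
      binom_Pascal[of "int t" "int r"] assms(1)
    by (simp add: block_coeff_def algebra_simps)
  consider (Nil) "ps = []" | (True) ps' where "ps = True # ps'" |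
    (False) ps' where "ps = False # ps'"
    by (cases ps) auto
  then show ?thesis
  proof cases
    case Nil
    then show ?thesis by (simp add: block_coeff_def)
  next
    case (True ps')
    then show ?thesis by (simp add: Pascal_True)
  next
    case (False ps')
    then show ?thesis
      using Pascal_True[of "map Not ps'" s ss r rs] assms
        block_coeff_swap[of _ "False # ps'"]
      by (simp add: interleave_swap add.commute)
  qed
qed

lemma block_coeff_replicate_True:
  assumes "length ts = length hs" "sum_list ts \<le> sum_list hs" "set ts \<subseteq> {1..}"
  shows "block_coeff (replicate (length hs) True) hs ts = (if ts = hs then 1 else 0)"
proof -
  have "tail_coeff True x (replicate (length hs) True) hs ts = (if ts = hs then 1 else 0)" for x
    using assms
  proof (induction hs arbitrary: x ts)
    case (Cons h hs)
    then obtain t ts' where ts: "ts = t # ts'" by (cases ts) auto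
    show ?case
    proof (cases "h \<le> t")
      case True
      then show ?thesis
        using Cons.prems ts Cons.IH[of ts' "x + int t - int h"] by (auto simp: binom_def)
    qed (use ts Cons.prems in \<open>auto simp: binom_def\<close>)
  qed simp
  then show ?thesis by (simp add: block_coeff_def)
qed

lemma tail_coeff_eq_prod:
  assumes "length hs = length ps" "length ts = length ps"
  shows "tail_coeff q x ps hs ts =
    (\<Prod>i<length ps. binom (int (ts ! i) - 1)
       (if ps ! i = (q # ps) ! i then int (hs ! i) - 1
        else x + (\<Sum>j\<le>i. int (ts ! j)) - (\<Sum>j\<le>i. int (hs ! j))))"
  using assms
proof (induction q x ps hs ts rule: tail_coeff.induct)
  case (2 q x p ps h hs t ts)
  then show ?case
    by (simp add: prod.lessThan_Suc_shift sum.atMost_Suc_shift algebra_simps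
        del: prod.lessThan_Suc sum.atMost_Suc cong: if_cong)
qed auto

subsection \<open>Shuffles as sums over interleavings\<close>

definition prepend :: "'x \<Rightarrow> ('x list \<Rightarrow>\<^sub>0 int) \<Rightarrow> ('x list \<Rightarrow>\<^sub>0 int)" where
  "prepend x = frag_extend (\<lambda>w. frag_of (x # w))"

lemma prepend_simps [simp]:
  "prepend x 0 = 0"
  "prepend x (frag_cmul c p) = frag_cmul c (prepend x p)"
  "prepend x (frag_of w) = frag_of (x # w)"
  by (simp_all add: prepend_def frag_extend_cmul)

lemma prepend_sum: "prepend x (\<Sum>i\<in>I. f i) = (\<Sum>i\<in>I. prepend x (f i))"
  by (cases "finite I") (simp_all add: prepend_def frag_extend_sum o_def)

lemma shuffle_words_Nil_right [simp]: "shuffle_words w [] = frag_of w"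
  by (cases w) auto

lemma shuffle_words_Cons_Cons:
  "shuffle_words (a # u) (b # v) =
     prepend a (shuffle_words u (b # v)) + prepend b (shuffle_words (a # u) v)"
  by (simp add: prepend_def)

declare shuffle_words.simps(3) [simp del]

definition block_term ::
    "(nat \<times> 'g) list \<Rightarrow> (nat \<times> 'g) list \<Rightarrow> bool list \<Rightarrow> nat list \<Rightarrow> ('g option list \<Rightarrow>\<^sub>0 int)" where
  "block_term us vs ps ts =
     frag_cmul (block_coeff ps (interleave ps (map fst us) (map fst vs)) ts)
       (frag_of (xword (zip ts (interleave ps (map snd us) (map snd vs)))))"

definition block_expansion ::
    "(nat \<times> 'g) list \<Rightarrow> (nat \<times> 'g) list \<Rightarrow> nat \<Rightarrow> ('g option list \<Rightarrow>\<^sub>0 int)" where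
  "block_expansion us vs m =
     (\<Sum>ps\<in>patterns (length us) (length vs).
        \<Sum>ts\<in>compositions (length us + length vs) m. block_term us vs ps ts)"

lemma block_term_swap:
  "set ts \<subseteq> {1..} \<Longrightarrow> block_term vs us (map Not ps) ts = block_term us vs ps ts"
  by (simp add: block_term_def interleave_swap block_coeff_swap)

lemma block_expansion_swap: "block_expansion vs us m = block_expansion us vs m"
proof -
  have "inj_on (map Not) P" for P :: "bool list set"
    by (rule inj_on_subset[of _ UNIV]) (auto intro: inj_mapI simp: inj_def)
  then show ?thesis
    unfolding block_expansion_def patterns_swap[of "length vs"]
    by (auto simp: sum.reindex block_term_swap compositions_def add.commute intro!: sum.cong)
qed

lemma block_expansion_0_right: "block_expansion us ((0, b) # vs) m = 0"
  unfolding block_expansion_def block_term_def block_coeff_def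
  by (intro sum.neutral ballI)
    (auto simp: tail_coeff_interleave_overdrawn dest: False_in_set_pattern)

lemma block_expansion_0_left: "block_expansion ((0, a) # us) vs m = 0"
  by (subst block_expansion_swap) (rule block_expansion_0_right)

lemma block_expansion_Nil_right:
  assumes "set us \<subseteq> {1..} \<times> UNIV"
  shows "block_expansion us [] (sum_list (map fst us)) = frag_of (xword us)"
proof -
  let ?hs = "map fst us" and ?ps = "replicate (length us) True"
  let ?T = "compositions (length us) (sum_list ?hs)"
  have "block_term us [] ?ps ts = (if ts = ?hs then frag_of (xword us) else 0)" if "ts \<in> ?T" for ts
    using that block_coeff_replicate_True[of ts ?hs] interleave_replicate_True[of ?hs]
      interleave_replicate_True[of "map snd us"]
    by (auto simp: block_term_def compositions_def zip_map_fst_snd)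
  then have "block_expansion us [] (sum_list ?hs) =
      (\<Sum>ts\<in>?T. if ts = ?hs then frag_of (xword us) else 0)"
    by (simp add: block_expansion_def patterns_0_right)
  moreover have "?hs \<in> ?T"
    using assms by (auto simp: compositions_def)
  ultimately show ?thesis
    by (simp add: finite_compositions)
qed

lemma block_term_True_1:
  assumes "set ts \<subseteq> {1..}"
  shows "block_term ((Suc r, a) # us) vs (True # ps) (1 # ts) =
    (if r = 0 then prepend (Some a) (block_term us vs ps ts) else 0)"
  using block_coeff_Cons_1[OF assms] by (simp add: block_term_def)

lemma block_term_False_1:
  assumes "set ts \<subseteq> {1..}"
  shows "block_term us ((Suc s, b) # vs) (False # ps) (1 # ts) =
    (if s = 0 then prepend (Some b) (block_term us vs ps ts) else 0)"
  using block_coeff_Cons_1[OF assms] by (simp add: block_term_def)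

lemma xword_Cons_Suc:
  "xword ((Suc r, a) # us) = (if r = 0 then Some a # xword us else None # xword ((r, a) # us))"
  by (cases r) auto

lemma block_term_Suc:
  assumes "ps \<noteq> []" "t \<ge> 1" "set ts \<subseteq> {1..}"
  shows "block_term ((Suc r, a) # us) ((Suc s, b) # vs) ps (Suc t # ts) =
    prepend None (block_term ((r, a) # us) ((Suc s, b) # vs) ps (t # ts)) +
    prepend None (block_term ((Suc r, a) # us) ((s, b) # vs) ps (t # ts))"
proof -
  obtain p ps' where "ps = p # ps'" using assms(1) by (cases ps) auto
  then have "xword (zip (Suc t # ts) (interleave ps (a # map snd us) (b # map snd vs))) =
      None # xword (zip (t # ts) (interleave ps (a # map snd us) (b # map snd vs)))"
    using assms(2) by (cases p) (simp_all add: xword_Cons_Suc del: xword_Cons)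
  then show ?thesis
    using block_coeff_Pascal[OF assms(2,3), of ps]
    by (simp add: block_term_def frag_cmul_distrib)
qed

lemma block_expansion_Suc_Suc:
  "block_expansion ((Suc r, a) # us) ((Suc s, b) # vs) (Suc m) =
     (if r = 0 then prepend (Some a) (block_expansion us ((Suc s, b) # vs) m) else 0) +
     (if s = 0 then prepend (Some b) (block_expansion ((Suc r, a) # us) vs m) else 0) +
     (prepend None (block_expansion ((r, a) # us) ((Suc s, b) # vs) m) +
      prepend None (block_expansion ((Suc r, a) # us) ((s, b) # vs) m))"
proof -
  let ?us = "(Suc r, a) # us" and ?vs = "(Suc s, b) # vs"
  let ?P = "patterns (Suc (length us)) (Suc (length vs))"
  let ?T = "\<lambda>n. compositions n m"
  have "block_expansion ?us ?vs (Suc m) =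
      (\<Sum>ps\<in>?P. \<Sum>ts\<in>?T (Suc (length us + length vs)). block_term ?us ?vs ps (1 # ts)) +
      (\<Sum>ps\<in>?P. \<Sum>ts\<in>?T (Suc (Suc (length us + length vs))).
         block_term ?us ?vs ps (Suc (hd ts) # tl ts))"
    by (simp add: block_expansion_def sum_compositions_Suc_Suc sum.distrib)
  also have "(\<Sum>ps\<in>?P. \<Sum>ts\<in>?T (Suc (length us + length vs)). block_term ?us ?vs ps (1 # ts)) =
      (if r = 0 then prepend (Some a) (block_expansion us ?vs m) else 0) +
      (if s = 0 then prepend (Some b) (block_expansion ?us vs m) else 0)"
    by (simp add: sum_patterns_Suc_Suc block_term_True_1 block_term_False_1 set_composition
        block_expansion_def prepend_sum del: One_nat_def cong: sum.cong_simp)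
  also have "(\<Sum>ps\<in>?P. \<Sum>ts\<in>?T (Suc (Suc (length us + length vs))).
        block_term ?us ?vs ps (Suc (hd ts) # tl ts)) =
      (\<Sum>ps\<in>?P. \<Sum>ts\<in>?T (Suc (Suc (length us + length vs))).
         prepend None (block_term ((r, a) # us) ?vs ps ts) +
         prepend None (block_term ?us ((s, b) # vs) ps ts))"
  proof (intro sum.cong refl)
    fix ps ts assume "ps \<in> ?P" and "ts \<in> ?T (Suc (Suc (length us + length vs)))"
    then have "ps \<noteq> []" "ts = hd ts # tl ts" "hd ts \<ge> 1" "set (tl ts) \<subseteq> {1..}"
      by (auto simp: compositions_def length_Suc_conv dest: length_pattern)
    then show "block_term ?us ?vs ps (Suc (hd ts) # tl ts) =
        prepend None (block_term ((r, a) # us) ?vs ps ts) +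
        prepend None (block_term ?us ((s, b) # vs) ps ts)"
      using block_term_Suc by metis
  qed
  also have "\<dots> = prepend None (block_expansion ((r, a) # us) ?vs m) +
      prepend None (block_expansion ?us ((s, b) # vs) m)"
    by (simp add: block_expansion_def prepend_sum sum.distrib)
  finally show ?thesis .
qed

lemma shuffle_words_xword_Suc_Suc:
  "shuffle_words (xword ((Suc r, a) # us)) (xword ((Suc s, b) # vs)) =
     (if r = 0 then prepend (Some a) (shuffle_words (xword us) (xword ((Suc s, b) # vs)))
      else prepend None (shuffle_words (xword ((r, a) # us)) (xword ((Suc s, b) # vs)))) +
     (if s = 0 then prepend (Some b) (shuffle_words (xword ((Suc r, a) # us)) (xword vs))
      else prepend None (shuffle_words (xword ((Suc r, a) # us)) (xword ((s, b) # vs))))"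
  unfolding xword_Cons_Suc by (simp add: shuffle_words_Cons_Cons del: xword_Cons)

lemma positive_word_cases:
  assumes "set us \<subseteq> {1..} \<times> UNIV"
  obtains "us = []" | r a us' where "us = (Suc r, a) # us'"
proof (cases us)
  case (Cons x us')
  with assms obtain r a where "x = (Suc r, a)"
    by (cases x) (auto simp: Suc_le_eq gr0_conv_Suc)
  with Cons that(2) show thesis by simp
qed (use that(1) in simp)

proposition shuffle_words_xword:
  assumes "set us \<subseteq> {1..} \<times> UNIV" "set vs \<subseteq> {1..} \<times> UNIV"
    and "sum_list (map fst us) + sum_list (map fst vs) = m"
  shows "shuffle_words (xword us) (xword vs) = block_expansion us vs m"
  using assms
proof (induction m arbitrary: us vs rule: less_induct)
  case (less m)
  consider (Nil_right) "vs = []" | (Nil_left) "us = []" |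
    (Cons_Cons) r a us' s b vs' where "us = (Suc r, a) # us'" "vs = (Suc s, b) # vs'"
    using positive_word_cases[OF less.prems(1)] positive_word_cases[OF less.prems(2)] by metis
  then show ?case
  proof cases
    case Nil_right
    with less.prems block_expansion_Nil_right[of us] show ?thesis by simp
  next
    case Nil_left
    with less.prems block_expansion_Nil_right[of vs] show ?thesis
      by (simp add: block_expansion_swap[of _ "[]"])
  next
    case (Cons_Cons r a us' s b vs')
    note us = Cons_Cons(1) and vs = Cons_Cons(2)
    obtain n where m: "m = Suc n"
      using less.prems(3) us by (cases m) auto
    have IH: "shuffle_words (xword us\<^sub>0) (xword vs\<^sub>0) = block_expansion us\<^sub>0 vs\<^sub>0 n"
      if "set us\<^sub>0 \<subseteq> {1..} \<times> UNIV" "set vs\<^sub>0 \<subseteq> {1..} \<times> UNIV"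
        "sum_list (map fst us\<^sub>0) + sum_list (map fst vs\<^sub>0) = n"
      for us\<^sub>0 vs\<^sub>0 :: "(nat \<times> 'a) list"
      using less.IH[of n us\<^sub>0 vs\<^sub>0] that m by simp
    show ?thesis
      using less.prems IH[of us' vs] IH[of us vs'] IH[of "(r, a) # us'" vs] IH[of us "(s, b) # vs'"]
      unfolding us vs m
      by (cases r; cases s) (simp_all add: shuffle_words_xword_Suc_Suc block_expansion_Suc_Suc
          block_expansion_0_left block_expansion_0_right del: xword_Cons)
  qed
qed

subsection \<open>Vectors as lists\<close>

definition entries :: "nat \<Rightarrow> (nat \<Rightarrow> 'x) \<Rightarrow> 'x list" where
  "entries n f = map f [1..<Suc n]"

lemma length_entries [simp]: "length (entries n f) = n"
  by (simp add: entries_def)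

lemma nth_entries [simp]: "i < n \<Longrightarrow> entries n f ! i = f (Suc i)"
  by (simp add: entries_def del: upt_Suc)

lemma set_entries [simp]: "set (entries n f) = f ` {1..n}"
  by (simp add: entries_def atLeastLessThanSuc_atLeastAtMost del: upt_Suc)

lemma map_entries [simp]: "map g (entries n f) = entries n (\<lambda>i. g (f i))"
  by (simp add: entries_def)

lemma sum_list_entries [simp]: "sum_list (entries n f) = (\<Sum>i=1..n. f i)"
  by (simp add: sum_list_sum_nth atLeast0LessThan sum.atLeast1_atMost_eq)

lemma entries_eq_iff: "entries n f = xs \<longleftrightarrow> length xs = n \<and> (\<forall>i<n. f (Suc i) = xs ! i)"
  by (auto simp: list_eq_iff_nth_eq)

lemma bij_betw_entries:
  "bij_betw (entries n) ({1..n} \<rightarrow>\<^sub>E A) {xs. length xs = n \<and> set xs \<subseteq> A}"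
proof (rule bij_betw_byWitness[where f' = "\<lambda>xs. restrict (\<lambda>i. xs ! (i - 1)) {1..n}"])
  show "\<forall>f\<in>{1..n} \<rightarrow>\<^sub>E A. restrict (\<lambda>i. entries n f ! (i - 1)) {1..n} = f"
    by (auto simp: fun_eq_iff PiE_iff extensional_def)
  show "\<forall>xs\<in>{xs. length xs = n \<and> set xs \<subseteq> A}. entries n (restrict (\<lambda>i. xs ! (i - 1)) {1..n}) = xs"
    by (auto simp: entries_eq_iff)
  show "entries n ` ({1..n} \<rightarrow>\<^sub>E A) \<subseteq> {xs. length xs = n \<and> set xs \<subseteq> A}"
    by (auto simp: PiE_iff)
  show "(\<lambda>xs. restrict (\<lambda>i. xs ! (i - 1)) {1..n}) ` {xs. length xs = n \<and> set xs \<subseteq> A} \<subseteq> {1..n} \<rightarrow>\<^sub>E A"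
    by (auto simp: subset_iff intro!: nth_mem)
qed

lemma sorted_wrt_less_entries_iff:
  fixes f :: "nat \<Rightarrow> 'x::linorder"
  shows "sorted_wrt (<) (entries n f) \<longleftrightarrow> strict_mono_on {1..n} f"
proof
  assume sorted: "sorted_wrt (<) (entries n f)"
  show "strict_mono_on {1..n} f"
  proof (rule strict_mono_onI)
    fix i j assume "i \<in> {1..n}" "j \<in> {1..n}" "i < j"
    with sorted_wrt_nth_less[OF sorted, of "i - 1" "j - 1"] show "f i < f j" by simp
  qed
qed (auto simp: sorted_wrt_iff_nth_less intro: strict_mono_onD)

lemma bij_betw_weight_set: "bij_betw (entries n) (weight_set n m) (compositions n m)"
proof -
  have "bij_betw (entries n) {t \<in> {1..n} \<rightarrow>\<^sub>E {1..}. (\<Sum>i=1..n. t i) = m}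
      {ts \<in> {ts. length ts = n \<and> set ts \<subseteq> {1..}}. sum_list ts = m}"
    by (rule bij_betw_Collect[OF bij_betw_entries]) simp
  also have "{ts \<in> {ts. length ts = n \<and> set ts \<subseteq> {1..}}. sum_list ts = m} = compositions n m"
    by (auto simp: compositions_def)
  finally show ?thesis by (simp add: weight_set_def)
qed

lemma word_eq_zip: "word n t c = zip (entries n t) (entries n c)"
  by (simp add: word_def entries_def zip_map_map zip_same_conv_map)

lemma map_fst_word [simp]: "map fst (word n t c) = entries n t"
  and map_snd_word [simp]: "map snd (word n t c) = entries n c"
  and length_word [simp]: "length (word n t c) = n"
  by (simp_all add: word_eq_zip)

subsection \<open>Pairs of order-preserving maps as patterns\<close>

definition merge_pattern :: "nat \<Rightarrow> nat \<Rightarrow> (nat \<Rightarrow> nat) \<times> (nat \<Rightarrow> nat) \<Rightarrow> bool list" where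
  "merge_pattern k l \<phi>\<psi> = entries (k + l) (\<lambda>i. i \<in> fst \<phi>\<psi> ` {1..k})"

lemma I_set_iff:
  "(\<phi>, \<psi>) \<in> I_set k l \<longleftrightarrow>
     \<phi> \<in> {1..k} \<rightarrow>\<^sub>E {1..k + l} \<and> \<psi> \<in> {1..l} \<rightarrow>\<^sub>E {1..k + l} \<and>
     strict_mono_on {1..k} \<phi> \<and> strict_mono_on {1..l} \<psi> \<and>
     \<psi> ` {1..l} = {1..k + l} - \<phi> ` {1..k}"
proof -
  have "\<phi> ` {1..k} \<inter> \<psi> ` {1..l} = {} \<and> \<phi> ` {1..k} \<union> \<psi> ` {1..l} = {1..k + l} \<longleftrightarrow>
      \<psi> ` {1..l} = {1..k + l} - \<phi> ` {1..k}" if "\<phi> \<in> {1..k} \<rightarrow>\<^sub>E {1..k + l}"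
    using PiE_mem[OF that] by blast
  then show ?thesis
    unfolding I_set_def strict_mono_iff_mono mem_Collect_eq case_prod_conv by meson
qed

lemma filter_upt_eq_entries:
  assumes "strict_mono_on {1..k} \<phi>" "\<phi> ` {1..k} = {i \<in> {1..n}. P i}"
  shows "filter P [1..<Suc n] = entries k \<phi>"
proof (rule strict_sorted_equal)
  show "sorted_wrt (<) (filter P [1..<Suc n])"
    by (intro sorted_wrt_filter sorted_wrt_upt)
  show "sorted_wrt (<) (entries k \<phi>)"
    using assms(1) by (simp add: sorted_wrt_less_entries_iff)
  show "set (filter P [1..<Suc n]) = set (entries k \<phi>)"
    using assms(2) by auto
qed

lemma filter_merge_pattern:
  assumes "(\<phi>, \<psi>) \<in> I_set k l"
  shows "filter (\<lambda>i. i \<in> \<phi> ` {1..k}) [1..<Suc (k + l)] = entries k \<phi>"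
    and "filter (\<lambda>i. i \<notin> \<phi> ` {1..k}) [1..<Suc (k + l)] = entries l \<psi>"
proof -
  have "\<phi> ` {1..k} \<subseteq> {1..k + l}"
    using assms PiE_mem[of \<phi>] by (auto simp only: I_set_iff)
  then have "\<phi> ` {1..k} = {i \<in> {1..k + l}. i \<in> \<phi> ` {1..k}}"
    by blast
  moreover have "\<psi> ` {1..l} = {i \<in> {1..k + l}. i \<notin> \<phi> ` {1..k}}"
    using assms by (simp only: I_set_iff set_diff_eq)
  ultimately show "filter (\<lambda>i. i \<in> \<phi> ` {1..k}) [1..<Suc (k + l)] = entries k \<phi>"
    and "filter (\<lambda>i. i \<notin> \<phi> ` {1..k}) [1..<Suc (k + l)] = entries l \<psi>"
    using assms unfolding I_set_iff by (blast intro: filter_upt_eq_entries)+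
qed

lemma ex_strict_mono_enumeration:
  assumes "length (filter P [1..<Suc n]) = k"
  obtains \<phi> where "\<phi> \<in> {1..k} \<rightarrow>\<^sub>E {1..n}" "strict_mono_on {1..k} \<phi>"
    "\<phi> ` {1..k} = {i \<in> {1..n}. P i}"
proof -
  have set_filter: "set (filter P [1..<Suc n]) = {i \<in> {1..n}. P i}"
    by (simp add: atLeastLessThanSuc_atLeastAtMost del: upt_Suc)
  then have "set (filter P [1..<Suc n]) \<subseteq> {1..n}" by blast
  with assms have "filter P [1..<Suc n] \<in> {xs. length xs = k \<and> set xs \<subseteq> {1..n}}"
    by (intro CollectI conjI)
  then obtain \<phi> where \<phi>: "filter P [1..<Suc n] = entries k \<phi>" "\<phi> \<in> {1..k} \<rightarrow>\<^sub>E {1..n}"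
    unfolding bij_betw_imp_surj_on[OF bij_betw_entries, symmetric] by (rule imageE)
  show thesis
  proof
    show "strict_mono_on {1..k} \<phi>"
      unfolding sorted_wrt_less_entries_iff[symmetric] \<phi>(1)[symmetric]
      by (intro sorted_wrt_filter sorted_wrt_upt)
    show "\<phi> ` {1..k} = {i \<in> {1..n}. P i}"
      using set_filter by (simp only: \<phi>(1) set_entries)
  qed (rule \<phi>(2))
qed

lemma inj_on_merge_pattern: "inj_on (merge_pattern k l) (I_set k l)"
proof (rule inj_onI, clarify)
  fix \<phi> \<psi> \<phi>' \<psi>'
  assume I: "(\<phi>, \<psi>) \<in> I_set k l" and I': "(\<phi>', \<psi>') \<in> I_set k l"
    and "merge_pattern k l (\<phi>, \<psi>) = merge_pattern k l (\<phi>', \<psi>')"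
  then have same_pattern: "i \<in> \<phi> ` {1..k} \<longleftrightarrow> i \<in> \<phi>' ` {1..k}"
    if "i \<in> set [1..<Suc (k + l)]" for i
    using that by (simp add: merge_pattern_def entries_def del: upt_Suc)
  have "entries k \<phi> = entries k \<phi>'" "entries l \<psi> = entries l \<psi>'"
    unfolding filter_merge_pattern[OF I, symmetric] filter_merge_pattern[OF I', symmetric]
    by (intro filter_cong refl; simp only: same_pattern)+
  then show "\<phi> = \<phi>' \<and> \<psi> = \<psi>'"
    using I I' inj_onD[OF bij_betw_imp_inj_on[OF bij_betw_entries]] unfolding I_set_iff by metis
qed

lemma merge_pattern_in_patterns:
  assumes "(\<phi>, \<psi>) \<in> I_set k l"
  shows "merge_pattern k l (\<phi>, \<psi>) \<in> patterns k l"
  unfolding merge_pattern_def entries_def fst_conv map_in_patterns_iff filter_merge_pattern[OF assms]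
  by simp

lemma pattern_in_merge_pattern_image:
  assumes ps: "ps \<in> patterns k l"
  shows "ps \<in> merge_pattern k l ` I_set k l"
proof -
  define P where "P i = ps ! (i - 1)" for i
  have ps_eq: "ps = entries (k + l) P"
    using length_pattern[OF ps] by (simp add: P_def list_eq_iff_nth_eq)
  have "length (filter P [1..<Suc (k + l)]) = k"
    and "length (filter (\<lambda>i. \<not> P i) [1..<Suc (k + l)]) = l"
    using ps unfolding ps_eq entries_def map_in_patterns_iff by blast+
  then obtain \<phi> \<psi> where
    \<phi>: "\<phi> \<in> {1..k} \<rightarrow>\<^sub>E {1..k + l}" "strict_mono_on {1..k} \<phi>"
      "\<phi> ` {1..k} = {i \<in> {1..k + l}. P i}"
    and \<psi>: "\<psi> \<in> {1..l} \<rightarrow>\<^sub>E {1..k + l}" "strict_mono_on {1..l} \<psi>"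
      "\<psi> ` {1..l} = {i \<in> {1..k + l}. \<not> P i}"
    by (elim ex_strict_mono_enumeration)
  have "(\<phi>, \<psi>) \<in> I_set k l"
    unfolding I_set_iff using \<phi> \<psi> by auto
  moreover have "merge_pattern k l (\<phi>, \<psi>) = ps"
    by (simp add: merge_pattern_def \<phi>(3) ps_eq list_eq_iff_nth_eq del: One_nat_def)
  ultimately show ?thesis by blast
qed

lemma bij_betw_merge_pattern: "bij_betw (merge_pattern k l) (I_set k l) (patterns k l)"
  using inj_on_merge_pattern merge_pattern_in_patterns pattern_in_merge_pattern_image
  by (intro bij_betw_imageI) auto

lemma interleave_merge_pattern:
  assumes "(\<phi>, \<psi>) \<in> I_set k l"
  shows "interleave (merge_pattern k l (\<phi>, \<psi>)) (entries k a) (entries l b) =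
    entries (k + l) (merge_vec k l (\<phi>, \<psi>) a b)"
proof -
  have inverse: "entries n c = map (\<lambda>i. c (the_inv_into {1..n} f i)) (entries n f)"
    if "strict_mono_on {1..n} f" for n c and f :: "nat \<Rightarrow> nat"
    using the_inv_into_f_f[OF strict_mono_on_imp_inj_on[OF that]] by (auto simp: entries_eq_iff)
  have "strict_mono_on {1..k} \<phi>" "strict_mono_on {1..l} \<psi>"
    using assms by (auto simp: I_set_iff)
  note inverse[OF this(1), of a] inverse[OF this(2), of b]
  then show ?thesis
    unfolding filter_merge_pattern[OF assms, symmetric]
    by (simp add: merge_pattern_def entries_def[of "k + l"] interleave_map_filter merge_vec_def
        del: upt_Suc)
qed

lemma shuffle_coeff_eq_block_coeff:
  assumes "t \<in> {1..k + l} \<rightarrow> {1..}"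
  shows "shuffle_coeff k l r s t \<phi>\<psi> =
    block_coeff (merge_pattern k l \<phi>\<psi>)
      (entries (k + l) (merge_vec k l \<phi>\<psi> r s)) (entries (k + l) t)"
proof -
  define p where "p i \<longleftrightarrow> i \<in> fst \<phi>\<psi> ` {1..k}" for i
  define h where "h = merge_vec k l \<phi>\<psi> r s"
  have eps: "eps k \<phi>\<psi> i = (if p i then 1 else -1)" for i
    by (simp add: eps_def p_def split: prod.split)
  have "shuffle_coeff k l r s t \<phi>\<psi> = (\<Prod>i<k + l. coeff_factor k l r s t \<phi>\<psi> (Suc i))"
    by (simp add: shuffle_coeff_def prod.atLeast1_atMost_eq)
  also have "\<dots> = (\<Prod>i<k + l. binom (int (t (Suc i)) - 1)
      (if p (Suc i) = (p 1 # entries (k + l) p) ! i then int (h (Suc i)) - 1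
       else (\<Sum>j\<le>i. int (t (Suc j))) - (\<Sum>j\<le>i. int (h (Suc j)))))"
  proof (rule prod.cong)
    fix i assume "i \<in> {..<k + l}"
    moreover have "(\<Sum>j=1..Suc i. f j) = (\<Sum>j\<le>i. f (Suc j))" for f :: "nat \<Rightarrow> int"
      by (simp add: sum.atLeast1_atMost_eq lessThan_Suc_atMost del: sum.cl_ivl_Suc)
    ultimately show "coeff_factor k l r s t \<phi>\<psi> (Suc i) = binom (int (t (Suc i)) - 1)
      (if p (Suc i) = (p 1 # entries (k + l) p) ! i then int (h (Suc i)) - 1
       else (\<Sum>j\<le>i. int (t (Suc j))) - (\<Sum>j\<le>i. int (h (Suc j))))"
      by (cases i) (auto simp: coeff_factor_def Let_def eps h_def
          simp del: sum.cl_ivl_Suc sum.atMost_Suc)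
  qed simp
  also have "\<dots> = tail_coeff (p 1) 0 (entries (k + l) p) (entries (k + l) h) (entries (k + l) t)"
    by (simp add: tail_coeff_eq_prod cong: if_cong prod.cong_simp sum.cong_simp)
  also have "\<dots> = block_coeff (entries (k + l) p) (entries (k + l) h) (entries (k + l) t)"
    using assms by (intro block_coeff_eq_tail_coeff[symmetric]) auto
  finally show ?thesis
    by (simp add: merge_pattern_def p_def[abs_def] h_def)
qed

subsection \<open>The product \<open>shuffle_rho\<close>\<close>

lemma rho_sum: "rho G (\<Sum>i\<in>I. f i) = (\<Sum>i\<in>I. rho G (f i))"
  by (cases "finite I") (simp_all add: rho_def frag_extend_sum o_def)

lemma rho_cmul: "rho G (frag_cmul c p) = frag_cmul c (rho G p)"
  by (simp add: rho_def frag_extend_cmul)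

lemma the_inv_into_rho_frag_of:
  assumes "w \<in> sH_words G"
  shows "the_inv_into (H1 G) (rho G) (frag_of w) = frag_of (xword w)"
proof (rule the_inv_into_f_eq)
  show "inj_on (rho G) (H1 G)" using bij_betw_rho by (rule bij_betw_imp_inj_on)
  show "rho G (frag_of (xword w)) = frag_of w" using assms by (rule rho_xword)
  show "frag_of (xword w) \<in> H1 G" using xword_in_H1_words[OF assms] by (simp add: H1_def)
qed

lemma shuffle_rho_frag_of:
  assumes "us \<in> sH_words G" "vs \<in> sH_words G"
  shows "shuffle_rho G (frag_of us) (frag_of vs) = rho G (shuffle_words (xword us) (xword vs))"
  using assms by (simp add: shuffle_rho_def shuffle_prod_def the_inv_into_rho_frag_of)

lemma word_in_sH_words:
  "t \<in> {1..n} \<rightarrow> {1..} \<Longrightarrow> c \<in> {1..n} \<rightarrow> G \<Longrightarrow> word n t c \<in> sH_words G"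
  by (auto simp: word_def sH_words_def Pi_iff simp del: upt_Suc)

lemma zip_interleave_in_sH_words:
  assumes "us \<in> sH_words G" "vs \<in> sH_words G" "set ts \<subseteq> {1..}"
  shows "zip ts (interleave ps (map snd us) (map snd vs)) \<in> sH_words G"
proof -
  have "set (map snd us) \<subseteq> G" "set (map snd vs) \<subseteq> G"
    using assms(1,2) by (auto simp: sH_words_def mem_Times_iff)
  then have "set (interleave ps (map snd us) (map snd vs)) \<subseteq> G"
    using set_interleave_subset[of ps "map snd us" "map snd vs"] by blast
  with assms(3) show ?thesis
    by (auto simp: sH_words_def dest: set_zip_leftD set_zip_rightD)
qed

proposition shuffle_rho_words:
  assumes "us \<in> sH_words G" "vs \<in> sH_words G"
  shows "shuffle_rho G (frag_of us) (frag_of vs) =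
    (\<Sum>ps\<in>patterns (length us) (length vs).
      \<Sum>ts\<in>compositions (length us + length vs) (sum_list (map fst us) + sum_list (map fst vs)).
        frag_cmul (block_coeff ps (interleave ps (map fst us) (map fst vs)) ts)
          (frag_of (zip ts (interleave ps (map snd us) (map snd vs)))))"
proof -
  have "set us \<subseteq> {1..} \<times> UNIV" "set vs \<subseteq> {1..} \<times> UNIV"
    using assms by (auto simp: sH_words_def)
  then have "shuffle_rho G (frag_of us) (frag_of vs) =
      rho G (block_expansion us vs (sum_list (map fst us) + sum_list (map fst vs)))"
    by (simp add: shuffle_rho_frag_of assms shuffle_words_xword)
  then show ?thesis
    using assms by (simp add: block_expansion_def block_term_def rho_sum rho_cmul rho_xword
        zip_interleave_in_sH_words compositions_def)
qed

theorem theorem2p1: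
  fixes G :: "'g set" and k l :: nat
    and r s :: "nat \<Rightarrow> nat" and a b :: "nat \<Rightarrow> 'g"
  assumes "k \<ge> 1" and "l \<ge> 1"
    and "r \<in> {1..k} \<rightarrow> {1..}" and "a \<in> {1..k} \<rightarrow> G"
    and "s \<in> {1..l} \<rightarrow> {1..}" and "b \<in> {1..l} \<rightarrow> G"
  shows "shuffle_rho G (frag_of (word k r a)) (frag_of (word l s b)) =
    (\<Sum>\<phi>\<psi>\<in>I_set k l. \<Sum>t\<in>weight_set (k + l) ((\<Sum>i=1..k. r i) + (\<Sum>i=1..l. s i)).
       frag_cmul (shuffle_coeff k l r s t \<phi>\<psi>)
         (frag_of (word (k + l) t (merge_vec k l \<phi>\<psi> a b))))"
proof -
  let ?m = "(\<Sum>i=1..k. r i) + (\<Sum>i=1..l. s i)"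
  have "word k r a \<in> sH_words G" "word l s b \<in> sH_words G"
    using assms by (simp_all add: word_in_sH_words)
  then have "shuffle_rho G (frag_of (word k r a)) (frag_of (word l s b)) =
      (\<Sum>ps\<in>patterns k l. \<Sum>ts\<in>compositions (k + l) ?m.
        frag_cmul (block_coeff ps (interleave ps (entries k r) (entries l s)) ts)
          (frag_of (zip ts (interleave ps (entries k a) (entries l b)))))"
    by (simp add: shuffle_rho_words)
  also have "\<dots> = (\<Sum>\<phi>\<psi>\<in>I_set k l. \<Sum>t\<in>weight_set (k + l) ?m.
      frag_cmul (shuffle_coeff k l r s t \<phi>\<psi>)
        (frag_of (word (k + l) t (merge_vec k l \<phi>\<psi> a b))))"
    unfolding sum.reindex_bij_betw[OF bij_betw_merge_pattern, symmetric]
      sum.reindex_bij_betw[OF bij_betw_weight_set, symmetric]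
    by (auto simp: interleave_merge_pattern shuffle_coeff_eq_block_coeff word_eq_zip
        weight_set_def PiE_iff intro!: sum.cong)
  finally show ?thesis .
qed

end
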